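(* Let $\mathbf P=(P,\leq,{}',0,1)$ be an orthogonal mlb-complete poset, and for $x,y\in P$ put $x\odot_S y:=y\wedge\operatorname{Min}U(x,y')$ and $x\rightarrow_S y:=x'\vee\operatorname{Max}L(x,y)$. Then the following are equivalent: (i) $\mathbf P$ is orthomodular. (ii) For all $x,y,z\in P$, $x\odot_S y\leq_2 z$ if and only if $x\leq_1 y\rightarrow_S z$.
   Context: For a poset $(P,\leq)$, $L(x,y)$ and $U(x,y)$ are the sets of common lower and upper bounds of $x,y$; $\operatorname{Max}A$, $\operatorname{Min}A$ are the sets of maximal, minimal elements of $A$. For $A,B\subseteq P$: $A\leq_1B$ means for every $x\in A$ there is $y\in B$ with $x\leq y$; $A\leq_2B$ means for every $y\in B$ there is $x\in A$ with $x\leq y$. Elements are identified with singletons. For $y\in P$, $A\subseteq P$: $y\vee A:=\{y\vee a\mid a\in A\}$, $y\wedge A:=\{y\wedge a\mid a\in A\}$ (these exist in the definitions above by orthogonality). An antitone involution is a unary operation ${}'$ with $x''=x$ such that $x\leq y$ implies $y'\leq x'$. An orthogonal poset is a bounded poset $(P,\leq,{}',0,1)$ with an antitone involution such that $x\vee y$ exists whenever $x\leq y'$. An orthogonal poset is orthomodular if ${}'$ is a complementation ($x\vee x'=1$, $x\wedge x'=0$) and $x\leq y$ implies $x\vee(y\wedge x')=y$. A poset is mlb-complete if for every finite subset $M$ and every lower bound $x$ of $M$ there is a maximal lower bound of $M$ above (or equal to) $x$. *)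

theory Defs
  imports Main
begin

text \<open>
  The poset is the whole type \<open>'a\<close> with its class order; the bounds \<open>0\<close> and \<open>1\<close> are
  \<open>bot\<close> and \<open>top\<close>. The unary operation written with a prime is an explicit parameter \<open>c\<close>.
\<close>

definition lower_bounds :: "'a::order set \<Rightarrow> 'a set" where
  "lower_bounds M = {l. \<forall>m\<in>M. l \<le> m}"

definition upper_bounds :: "'a::order set \<Rightarrow> 'a set" where
  "upper_bounds M = {u. \<forall>m\<in>M. m \<le> u}"

abbreviation L :: "'a::order \<Rightarrow> 'a \<Rightarrow> 'a set" where
  "L x y \<equiv> lower_bounds {x, y}"

abbreviation U :: "'a::order \<Rightarrow> 'a \<Rightarrow> 'a set" where
  "U x y \<equiv> upper_bounds {x, y}"

definition maximals :: "'a::order set \<Rightarrow> 'a set" where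
  "maximals A = {a \<in> A. \<forall>b\<in>A. a \<le> b \<longrightarrow> b = a}"

definition minimals :: "'a::order set \<Rightarrow> 'a set" where
  "minimals A = {a \<in> A. \<forall>b\<in>A. b \<le> a \<longrightarrow> b = a}"

definition le1 :: "'a::order set \<Rightarrow> 'a set \<Rightarrow> bool" (infix "\<le>\<^sub>1" 50) where
  "A \<le>\<^sub>1 B \<longleftrightarrow> (\<forall>x\<in>A. \<exists>y\<in>B. x \<le> y)"

definition le2 :: "'a::order set \<Rightarrow> 'a set \<Rightarrow> bool" (infix "\<le>\<^sub>2" 50) where
  "A \<le>\<^sub>2 B \<longleftrightarrow> (\<forall>y\<in>B. \<exists>x\<in>A. x \<le> y)"

text \<open>
  Joins and meets are partial: \<open>join x y\<close> and \<open>meet x y\<close> are unspecified when the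
  supremum or infimum does not exist. Every use below is on a pair for which the axioms of an
  orthogonal poset guarantee existence (for meets, via \<open>x \<and> y = (x' \<or> y')'\<close>).
\<close>

definition has_join :: "'a::order \<Rightarrow> 'a \<Rightarrow> bool" where
  "has_join x y \<longleftrightarrow> (\<exists>s \<in> U x y. \<forall>u \<in> U x y. s \<le> u)"

definition join :: "'a::order \<Rightarrow> 'a \<Rightarrow> 'a" where
  "join x y = (LEAST s. s \<in> U x y)"

definition meet :: "'a::order \<Rightarrow> 'a \<Rightarrow> 'a" where
  "meet x y = (GREATEST s. s \<in> L x y)"

definition antitone_involution :: "('a::order \<Rightarrow> 'a) \<Rightarrow> bool" where
  "antitone_involution c \<longleftrightarrow> antimono c \<and> (\<forall>x. c (c x) = x)"

definition orthogonal_poset :: "('a::{order_bot,order_top} \<Rightarrow> 'a) \<Rightarrow> bool" where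
  "orthogonal_poset c \<longleftrightarrow>
     antitone_involution c \<and> (\<forall>x y. x \<le> c y \<longrightarrow> has_join x y)"

definition complementation :: "('a::{order_bot,order_top} \<Rightarrow> 'a) \<Rightarrow> bool" where
  "complementation c \<longleftrightarrow> (\<forall>x. join x (c x) = top \<and> meet x (c x) = bot)"

definition orthomodular_poset :: "('a::{order_bot,order_top} \<Rightarrow> 'a) \<Rightarrow> bool" where
  "orthomodular_poset c \<longleftrightarrow>
     orthogonal_poset c \<and> complementation c \<and>
     (\<forall>x y. x \<le> y \<longrightarrow> join x (meet y (c x)) = y)"

text \<open>The \<open>itself\<close> argument only selects the poset, i.e. the type with its class order.\<close>

definition mlb_complete :: "'a::order itself \<Rightarrow> bool" where
  "mlb_complete _ \<longleftrightarrow>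
     (\<forall>M::'a set. finite M \<longrightarrow>
        (\<forall>x \<in> lower_bounds M. \<exists>m \<in> maximals (lower_bounds M). x \<le> m))"

definition sasaki_prod :: "('a::{order_bot,order_top} \<Rightarrow> 'a) \<Rightarrow> 'a \<Rightarrow> 'a \<Rightarrow> 'a set" where
  "sasaki_prod c x y = meet y ` minimals (U x (c y))"

definition sasaki_imp :: "('a::{order_bot,order_top} \<Rightarrow> 'a) \<Rightarrow> 'a \<Rightarrow> 'a \<Rightarrow> 'a set" where
  "sasaki_imp c x y = join (c x) ` maximals (L x y)"

end

theory Submission
  imports Defs
begin

text \<open>
  Orthomodularity is the statement \<open>w = y' \<or> (y \<and> w)\<close> for \<open>y' \<le> w\<close>, or dually
  \<open>m = y \<and> (y' \<or> m)\<close> for \<open>m \<le> y\<close>. These two identities carry \<open>x \<le> w\<close> with \<open>y \<and> w \<le> z\<close> to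
  \<open>x \<le> y' \<or> m\<close> with \<open>m \<le> y, z\<close> and back; mlb-completeness replaces the bounds so obtained by
  extremal ones. Conversely, adjointness at \<open>(1, y, y)\<close> yields \<open>y' \<or> y = 1\<close>, and at
  \<open>(w, y, y \<and> w)\<close> with \<open>y' \<le> w\<close> it yields \<open>w \<le> y' \<or> (y \<and> w)\<close>.
\<close>

lemma lower_bounds_pair_iff: "l \<in> L x y \<longleftrightarrow> l \<le> x \<and> l \<le> y"
  by (simp add: lower_bounds_def)

lemma upper_bounds_pair_iff: "u \<in> U x y \<longleftrightarrow> x \<le> u \<and> y \<le> u"
  by (simp add: upper_bounds_def)

lemma join_equality:
  assumes "x \<le> s" "y \<le> s" "\<And>u. x \<le> u \<Longrightarrow> y \<le> u \<Longrightarrow> s \<le> u"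
  shows "join x y = s"
  unfolding join_def by (rule Least_equality) (auto simp: upper_bounds_pair_iff assms)

lemma meet_equality:
  assumes "s \<le> x" "s \<le> y" "\<And>l. l \<le> x \<Longrightarrow> l \<le> y \<Longrightarrow> l \<le> s"
  shows "meet x y = s"
  unfolding meet_def by (rule Greatest_equality) (auto simp: lower_bounds_pair_iff assms)

lemma join_commute: "join x y = join y x"
  by (simp add: join_def insert_commute)

lemma meet_commute: "meet x y = meet y x"
  by (simp add: meet_def insert_commute)

text \<open>For a comparable pair the set of bounds has an extreme element. This and its dual turn
  the existential in the adjointness condition into a single inequality.\<close>

lemma maximals_lower_bounds_of_le:
  assumes "x \<le> y"
  shows "maximals (L y x) = {x}"
  using assms by (auto simp: maximals_def lower_bounds_pair_iff)

lemma minimals_upper_bounds_of_le: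
  assumes "y \<le> x"
  shows "minimals (U x y) = {x}"
  using assms by (auto simp: minimals_def upper_bounds_pair_iff)

lemma ex_maximal_lower_bound:
  fixes x y :: "'a::order"
  assumes "mlb_complete TYPE('a)" "l \<le> x" "l \<le> y"
  shows "\<exists>m \<in> maximals (L x y). l \<le> m"
proof -
  have "finite {x, y}" "l \<in> L x y" using assms by (auto simp: lower_bounds_pair_iff)
  then show ?thesis using assms(1) unfolding mlb_complete_def by blast
qed

context
  fixes c :: "'a::{order_bot,order_top} \<Rightarrow> 'a"
  assumes orthogonal: "orthogonal_poset c"
begin

lemma compl_compl: "c (c x) = x"
  using orthogonal by (simp add: orthogonal_poset_def antitone_involution_def)

lemma compl_antimono: "x \<le> y \<Longrightarrow> c y \<le> c x"
  using orthogonal by (simp add: orthogonal_poset_def antitone_involution_def antimono_def)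

lemma compl_le_swap: "c x \<le> y \<longleftrightarrow> c y \<le> x"
  by (metis compl_antimono compl_compl)

lemma le_compl_swap: "x \<le> c y \<longleftrightarrow> y \<le> c x"
  by (metis compl_antimono compl_compl)

lemma compl_top: "c top = bot"
  by (metis bot.extremum compl_le_swap le_bot top_greatest)

text \<open>\<open>join\<close> is a \<open>LEAST\<close> term and carries information only once a
  supremum exists; orthogonality supplies one, which makes these rules available.\<close>

lemma join_orthogonal:
  assumes "x \<le> c y"
  shows "x \<le> join x y" "y \<le> join x y" "\<And>u. x \<le> u \<Longrightarrow> y \<le> u \<Longrightarrow> join x y \<le> u"
proof -
  obtain s where s: "x \<le> s" "y \<le> s" "\<And>u. x \<le> u \<Longrightarrow> y \<le> u \<Longrightarrow> s \<le> u"
    using orthogonal assms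
    unfolding orthogonal_poset_def has_join_def Bex_def Ball_def upper_bounds_pair_iff by blast
  moreover from s have "join x y = s" by (rule join_equality)
  ultimately show "x \<le> join x y" "y \<le> join x y" "\<And>u. x \<le> u \<Longrightarrow> y \<le> u \<Longrightarrow> join x y \<le> u"
    by auto
qed

text \<open>De Morgan: \<open>c\<close> reverses the order, so it carries the supremum of
  \<open>c x\<close> and \<open>c y\<close> to the infimum of \<open>x\<close> and \<open>y\<close>.
  The hypothesis is orthogonality of \<open>c x\<close> and \<open>c y\<close>, since
  \<open>y = c (c y)\<close>.\<close>

lemma compl_join_is_meet:
  assumes "c x \<le> y"
  shows "c (join (c x) (c y)) \<le> x" "c (join (c x) (c y)) \<le> y"
    "\<And>l. l \<le> x \<Longrightarrow> l \<le> y \<Longrightarrow> l \<le> c (join (c x) (c y))"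
proof -
  have "c x \<le> c (c y)" using assms by (simp add: compl_compl)
  note j = join_orthogonal[OF this]
  show "c (join (c x) (c y)) \<le> x" using j(1) by (subst compl_le_swap)
  show "c (join (c x) (c y)) \<le> y" using j(2) by (subst compl_le_swap)
  fix l assume "l \<le> x" "l \<le> y"
  then show "l \<le> c (join (c x) (c y))"
    by (subst le_compl_swap) (intro j(3) compl_antimono)
qed

lemma meet_eq_compl_join:
  assumes "c x \<le> y"
  shows "meet x y = c (join (c x) (c y))"
  using compl_join_is_meet[OF assms] by (rule meet_equality)

lemma meet_orthogonal:
  assumes "c x \<le> y"
  shows "meet x y \<le> x" "meet x y \<le> y" "\<And>l. l \<le> x \<Longrightarrow> l \<le> y \<Longrightarrow> l \<le> meet x y"
  using compl_join_is_meet[OF assms] by (simp_all add: meet_eq_compl_join[OF assms])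

lemma orthomodular_join_meet:
  assumes "orthomodular_poset c" "c y \<le> w"
  shows "join (c y) (meet y w) = w"
  using assms unfolding orthomodular_poset_def by (metis compl_compl meet_commute)

text \<open>Apply \<open>c\<close> to the preceding identity with \<open>w = c m\<close>.\<close>

lemma orthomodular_meet_join:
  assumes "orthomodular_poset c" "m \<le> y"
  shows "meet y (join (c y) m) = m"
proof -
  have ym: "c y \<le> c m" using assms(2) by (rule compl_antimono)
  have "meet y (join (c y) m) = c (join (c y) (c (join (c y) m)))"
    by (rule meet_eq_compl_join) (rule join_orthogonal(1)[OF ym])
  also have "c (join (c y) m) = meet y (c m)"
    using meet_eq_compl_join[OF ym] by (simp add: compl_compl)
  also have "join (c y) (meet y (c m)) = c m"
    using assms(1) ym by (rule orthomodular_join_meet)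
  finally show ?thesis by (simp add: compl_compl)
qed

text \<open>mlb-completeness speaks of lower bounds; \<open>c\<close> exchanges maximal lower bounds
  of \<open>c x\<close>, \<open>c y\<close> with minimal upper bounds of \<open>x\<close>,
  \<open>y\<close>.\<close>

lemma ex_minimal_upper_bound:
  fixes x y :: 'a
  assumes "mlb_complete TYPE('a)" "x \<le> u" "y \<le> u"
  shows "\<exists>w \<in> minimals (U x y). w \<le> u"
proof -
  obtain m where m: "m \<in> maximals (L (c x) (c y))" "c u \<le> m"
    using ex_maximal_lower_bound[OF assms(1) assms(2,3)[THEN compl_antimono]] by blast
  have "b = c m" if "b \<in> U x y" "b \<le> c m" for b
  proof -
    have "c b \<in> L (c x) (c y)"
      using that(1) by (simp add: upper_bounds_pair_iff lower_bounds_pair_iff compl_antimono)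
    moreover have "m \<le> c b" using that(2) by (subst le_compl_swap)
    ultimately have "c b = m" using m(1) by (simp add: maximals_def)
    then show ?thesis by (metis compl_compl)
  qed
  moreover have "c m \<in> U x y"
    using m(1) by (simp add: maximals_def upper_bounds_pair_iff lower_bounds_pair_iff
        le_compl_swap[of m])
  ultimately have "c m \<in> minimals (U x y)" by (auto simp: minimals_def)
  moreover have "c m \<le> u" using m(2) by (subst compl_le_swap)
  ultimately show ?thesis by blast
qed

lemma sasaki_prod_le2_iff:
  "sasaki_prod c x y \<le>\<^sub>2 {z} \<longleftrightarrow> (\<exists>w \<in> minimals (U x (c y)). meet y w \<le> z)"
  by (auto simp: sasaki_prod_def le2_def)

lemma le1_sasaki_imp_iff:
  "{x} \<le>\<^sub>1 sasaki_imp c y z \<longleftrightarrow> (\<exists>m \<in> maximals (L y z). x \<le> join (c y) m)"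
  by (auto simp: sasaki_imp_def le1_def)

lemma orthomodular_imp_sasaki_adjoint:
  assumes "mlb_complete TYPE('a)" "orthomodular_poset c"
  shows "sasaki_prod c x y \<le>\<^sub>2 {z} \<longleftrightarrow> {x} \<le>\<^sub>1 sasaki_imp c y z"
  unfolding sasaki_prod_le2_iff le1_sasaki_imp_iff
proof
  assume "\<exists>w \<in> minimals (U x (c y)). meet y w \<le> z"
  then obtain w where w: "x \<le> w" "c y \<le> w" "meet y w \<le> z"
    by (auto simp: minimals_def upper_bounds_pair_iff)
  obtain m where m: "m \<in> maximals (L y z)" "meet y w \<le> m"
    using ex_maximal_lower_bound[OF assms(1) meet_orthogonal(1)[OF w(2)] w(3)] by blast
  then have "m \<le> y" by (auto simp: maximals_def lower_bounds_pair_iff)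
  note j = join_orthogonal[OF compl_antimono[OF this]]
  note jw = join_orthogonal[OF compl_antimono[OF meet_orthogonal(1)[OF w(2)]]]
  \<comment> \<open>Orthomodularity recovers \<open>w\<close> from \<open>meet y w\<close>, so
    enlarging \<open>meet y w\<close> to \<open>m\<close> can only enlarge the join.\<close>
  have "w = join (c y) (meet y w)"
    using orthomodular_join_meet[OF assms(2) w(2)] by simp
  also have "\<dots> \<le> join (c y) m"
    using j(1,2) m(2) by (intro jw(3)) (auto intro: order_trans)
  finally show "\<exists>m \<in> maximals (L y z). x \<le> join (c y) m"
    using m(1) w(1) by (blast intro: order_trans)
next
  assume "\<exists>m \<in> maximals (L y z). x \<le> join (c y) m"
  then obtain m where m: "m \<le> y" "m \<le> z" "x \<le> join (c y) m"
    by (auto simp: maximals_def lower_bounds_pair_iff)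
  have yj: "c y \<le> join (c y) m"
    using compl_antimono[OF m(1)] by (rule join_orthogonal(1))
  \<comment> \<open>The element \<open>join (c y) m\<close> bounds both \<open>x\<close> and
    \<open>c y\<close> from above, so a minimal upper bound lies below it.\<close>
  obtain w where w: "w \<in> minimals (U x (c y))" "w \<le> join (c y) m"
    using ex_minimal_upper_bound[OF assms(1) m(3) yj] by blast
  then have "c y \<le> w" by (auto simp: minimals_def upper_bounds_pair_iff)
  note mw = meet_orthogonal[OF this]
  have "meet y w \<le> meet y (join (c y) m)"
    using mw(1,2) w(2) by (intro meet_orthogonal(3)[OF yj]) (auto intro: order_trans)
  also have "\<dots> = m" using assms(2) m(1) by (rule orthomodular_meet_join)
  finally show "\<exists>w \<in> minimals (U x (c y)). meet y w \<le> z"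
    using w(1) m(2) by (blast intro: order_trans)
qed

lemma sasaki_adjoint_imp_orthomodular:
  assumes "mlb_complete TYPE('a)"
    and adj: "\<And>x y z. sasaki_prod c x y \<le>\<^sub>2 {z} \<longleftrightarrow> {x} \<le>\<^sub>1 sasaki_imp c y z"
  shows "orthomodular_poset c"
proof -
  have adj_imp: "\<exists>m \<in> maximals (L y z). x \<le> join (c y) m"
    if "w \<in> minimals (U x (c y))" "meet y w \<le> z" for x y z w
    using that by (intro adj[unfolded sasaki_prod_le2_iff le1_sasaki_imp_iff, THEN iffD1] bexI)
  have join_compl: "join y (c y) = top" for y
  proof -
    obtain w where w: "w \<in> minimals (U top (c y))"
      using ex_minimal_upper_bound[OF assms(1), of top top "c y"] by auto
    then have "c y \<le> w" by (auto simp: minimals_def upper_bounds_pair_iff)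
    then have "meet y w \<le> y" by (rule meet_orthogonal(1))
    \<comment> \<open>Adjointness at \<open>(top, y, y)\<close>: the maximal lower bound it yields
      must be \<open>y\<close> itself.\<close>
    from adj_imp[OF w this] have "top \<le> join (c y) y"
      unfolding maximals_lower_bounds_of_le[OF order_refl] by blast
    then show ?thesis unfolding join_commute[of y] by (rule top_le)
  qed
  have meet_compl: "meet y (c y) = bot" for y
    \<comment> \<open>De Morgan reduces this to the complement of \<open>top\<close>.\<close>
    using meet_eq_compl_join[of y "c y", OF order_refl] join_compl[of "c y"]
    by (simp add: compl_top)
  have "join x (meet y (c x)) = y" if "x \<le> y" for x y
  proof (rule antisym)
    have xy: "c (c x) \<le> y" using that by (simp add: compl_compl)
    note mt = meet_orthogonal[OF this]
    \<comment> \<open>Prepares adjointness at \<open>(y, c x, meet (c x) y)\<close>, where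
      \<open>y\<close> is the least upper bound of \<open>y\<close> and
      \<open>x = c (c x)\<close>.\<close>
    have "y \<in> minimals (U y (c (c x)))"
      unfolding minimals_upper_bounds_of_le[OF xy] by simp
    from adj_imp[OF this order_refl] show "y \<le> join x (meet y (c x))"
      by (simp add: maximals_lower_bounds_of_le[OF mt(1)] compl_compl meet_commute[of y])
    \<comment> \<open>Orthogonality of \<open>x\<close> and \<open>meet y (c x)\<close> ensures that
      their join is a genuine supremum.\<close>
    have "x \<le> c (meet y (c x))" using mt(1) unfolding meet_commute[of y] by (subst le_compl_swap)
    then show "join x (meet y (c x)) \<le> y"
      using that mt(2) by (intro join_orthogonal(3)) (simp_all add: meet_commute[of y])
  qed
  then show ?thesis
    using orthogonal join_compl meet_compl
    by (simp add: orthomodular_poset_def complementation_def)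
qed

end

theorem theorem7p6:
  fixes c :: "'a::{order_bot,order_top} \<Rightarrow> 'a"
  assumes "orthogonal_poset c"
    and "mlb_complete TYPE('a)"
  shows "orthomodular_poset c \<longleftrightarrow>
    (\<forall>x y z. sasaki_prod c x y \<le>\<^sub>2 {z} \<longleftrightarrow> {x} \<le>\<^sub>1 sasaki_imp c y z)"
  using orthomodular_imp_sasaki_adjoint[OF assms] sasaki_adjoint_imp_orthomodular[OF assms]
  by blast

end
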